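(* Let $G$ be a connected simple infinite graph that is not locally finite. Then no compactification of (the 1-complex of) $G$ is both Hausdorff and has a totally disconnected remainder; that is, there is no compact Hausdorff space $\alpha G$ containing the 1-complex $G$ as a dense subspace such that $\alpha G\setminus G$ is totally disconnected.
   Context: 1-complex: $G=(V,E)$ also denotes its 1-complex, in which every edge $e=xy$ is a copy $[x,y]=\{x\}\sqcup\mathring e\sqcup\{y\}$ of $[0,1]$ with $\mathring e$ (the inner edge points) corresponding to $(0,1)$; the point set is $V\sqcup\bigsqcup_{e\in E}\mathring e$, inner edge points have their usual basic open neighbourhoods inside $\mathring e$, and a neighbourhood basis of a vertex $v$ consists of all unions $\bigcup_{e\in E(v)}[v,i_e)$ with $i_e\in\mathring e$ arbitrary, $E(v)$ being the set of edges incident with $v$. A graph is locally finite if every vertex has finite degree. A compactification of a space is a compact space containing it as a dense subspace; its remainder is the complement of that subspace. *)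

theory Defs
  imports "HOL-Analysis.Analysis"
begin

section \<open>Simple graphs\<close>

definition simple_graph :: "'a set \<Rightarrow> 'a set set \<Rightarrow> bool" where
  "simple_graph V E \<longleftrightarrow> (\<forall>e\<in>E. \<exists>x\<in>V. \<exists>y\<in>V. x \<noteq> y \<and> e = {x, y})"

definition incident_edges :: "'a set set \<Rightarrow> 'a \<Rightarrow> 'a set set" where
  "incident_edges E v = {e \<in> E. v \<in> e}"

definition graph_connected :: "'a set \<Rightarrow> 'a set set \<Rightarrow> bool" where
  "graph_connected V E \<longleftrightarrow>
     V \<noteq> {} \<and> (\<forall>u\<in>V. \<forall>v\<in>V. (u, v) \<in> {(x, y). {x, y} \<in> E}\<^sup>*)"

definition locally_finite_graph :: "'a set \<Rightarrow> 'a set set \<Rightarrow> bool" where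
  "locally_finite_graph V E \<longleftrightarrow> (\<forall>v\<in>V. finite (incident_edges E v))"


section \<open>The 1-complex of a graph\<close>

text \<open>
  The inner points of an edge \<open>e = {x, y}\<close> are \<open>Inner e t\<close> with \<open>0 < t < 1\<close>. To identify
  \<open>e\<close> with a copy of the unit interval, one of its endpoints has to be placed at \<open>0\<close>;
  \<open>base_end e\<close> is an arbitrary choice of such an endpoint. The space does not depend on
  it, up to the homeomorphism that replaces \<open>t\<close> by \<open>1 - t\<close> on some edges.
\<close>

datatype 'a complex_point = Vertex 'a | Inner "'a set" real

definition inner_points :: "'a set \<Rightarrow> 'a complex_point set" where
  "inner_points e = Inner e ` {0<..<1}"

definition complex_points :: "'a set \<Rightarrow> 'a set set \<Rightarrow> 'a complex_point set" where
  "complex_points V E = Vertex ` V \<union> (\<Union>e\<in>E. inner_points e)"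

definition base_end :: "'a set \<Rightarrow> 'a" where
  "base_end e = (SOME x. x \<in> e)"

definition dist_from_end :: "'a \<Rightarrow> 'a set \<Rightarrow> real \<Rightarrow> real" where
  "dist_from_end v e t = (if v = base_end e then t else 1 - t)"

text \<open>
  For an endpoint \<open>v\<close> of \<open>e\<close> and \<open>0 < s < 1\<close>, this is the half-open segment \<open>[v, i)\<close> of \<open>e\<close>,
  where \<open>i\<close> is the inner point of \<open>e\<close> at distance \<open>s\<close> from \<open>v\<close>.
\<close>

definition half_open_segment :: "'a \<Rightarrow> 'a set \<Rightarrow> real \<Rightarrow> 'a complex_point set" where
  "half_open_segment v e s =
     insert (Vertex v) {Inner e t | t. t \<in> {0<..<1} \<and> dist_from_end v e t < s}"

text \<open>
  The explicit \<open>Vertex v\<close> in a basic neighbourhood of \<open>v\<close> only matters if \<open>v\<close> is isolated,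
  where the union is empty.
\<close>

fun nbhd_basis :: "'a set set \<Rightarrow> 'a complex_point \<Rightarrow> 'a complex_point set set" where
  "nbhd_basis E (Vertex v) =
     {insert (Vertex v) (\<Union>e\<in>incident_edges E v. half_open_segment v e (i e)) | i.
        \<forall>e\<in>incident_edges E v. i e \<in> {0<..<1}}"
| "nbhd_basis E (Inner e t) =
     {Inner e ` {a<..<b} | a b. 0 \<le> a \<and> a < t \<and> t < b \<and> b \<le> 1}"

definition one_complex_open :: "'a set \<Rightarrow> 'a set set \<Rightarrow> 'a complex_point set \<Rightarrow> bool" where
  "one_complex_open V E U \<longleftrightarrow>
     U \<subseteq> complex_points V E \<and> (\<forall>p\<in>U. \<exists>B\<in>nbhd_basis E p. B \<subseteq> U)"

definition one_complex :: "'a set \<Rightarrow> 'a set set \<Rightarrow> 'a complex_point topology" where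
  "one_complex V E = topology (one_complex_open V E)"

lemma nbhd_basis_Int:
  assumes "B \<in> nbhd_basis E p" "C \<in> nbhd_basis E p"
  shows "\<exists>D\<in>nbhd_basis E p. D \<subseteq> B \<inter> C"
proof (cases p)
  case (Vertex v)
  obtain i where i: "\<forall>e\<in>incident_edges E v. i e \<in> {0<..<1::real}"
      "B = insert (Vertex v) (\<Union>e\<in>incident_edges E v. half_open_segment v e (i e))"
    using assms(1) unfolding Vertex nbhd_basis.simps by blast
  obtain j where j: "\<forall>e\<in>incident_edges E v. j e \<in> {0<..<1::real}"
      "C = insert (Vertex v) (\<Union>e\<in>incident_edges E v. half_open_segment v e (j e))"
    using assms(2) unfolding Vertex nbhd_basis.simps by blast
  let ?k = "\<lambda>e. min (i e) (j e)"
  let ?D = "insert (Vertex v) (\<Union>e\<in>incident_edges E v. half_open_segment v e (?k e))"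
  have "\<forall>e\<in>incident_edges E v. ?k e \<in> {0<..<1}"
    using i(1) j(1) by (simp add: min_less_iff_disj)
  then have "?D \<in> nbhd_basis E p"
    unfolding Vertex nbhd_basis.simps mem_Collect_eq by (intro exI[of _ ?k]) blast
  moreover have "half_open_segment v e (?k e) \<subseteq> half_open_segment v e (i e)"
    "half_open_segment v e (?k e) \<subseteq> half_open_segment v e (j e)" for e
    unfolding half_open_segment_def by auto
  then have "?D \<subseteq> B \<inter> C"
    unfolding i(2) j(2) by blast
  ultimately show ?thesis by blast
next
  case (Inner e t)
  obtain a b where ab: "0 \<le> a" "a < t" "t < b" "b \<le> 1" "B = Inner e ` {a<..<b}"
    using assms(1) Inner by auto
  obtain c d where cd: "0 \<le> c" "c < t" "t < d" "d \<le> 1" "C = Inner e ` {c<..<d}"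
    using assms(2) Inner by auto
  let ?D = "Inner e ` {max a c<..<min b d}"
  have "0 \<le> max a c \<and> max a c < t \<and> t < min b d \<and> min b d \<le> 1"
    using ab cd by auto
  then have "?D \<in> nbhd_basis E p"
    unfolding Inner nbhd_basis.simps by blast
  moreover have "?D \<subseteq> B \<inter> C"
    unfolding ab(5) cd(5) by auto
  ultimately show ?thesis by blast
qed

lemma istopology_one_complex_open: "istopology (one_complex_open V E)"
  unfolding istopology_def
proof (intro conjI allI impI)
  fix S T
  assume S: "one_complex_open V E S" and T: "one_complex_open V E T"
  have "\<exists>D\<in>nbhd_basis E p. D \<subseteq> S \<inter> T" if p: "p \<in> S \<inter> T" for p
  proof -
    obtain B where B: "B \<in> nbhd_basis E p" "B \<subseteq> S"
      using S p unfolding one_complex_open_def by blast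
    obtain C where C: "C \<in> nbhd_basis E p" "C \<subseteq> T"
      using T p unfolding one_complex_open_def by blast
    obtain D where "D \<in> nbhd_basis E p" "D \<subseteq> B \<inter> C"
      using nbhd_basis_Int[OF B(1) C(1)] by blast
    then show ?thesis
      using B C by blast
  qed
  then show "one_complex_open V E (S \<inter> T)"
    using S unfolding one_complex_open_def by blast
next
  fix K
  assume K: "\<forall>S\<in>K. one_complex_open V E S"
  have "\<exists>B\<in>nbhd_basis E p. B \<subseteq> \<Union>K" if p: "p \<in> \<Union>K" for p
  proof -
    obtain S where S: "S \<in> K" "p \<in> S"
      using p by auto
    then obtain B where "B \<in> nbhd_basis E p" "B \<subseteq> S"
      using K unfolding one_complex_open_def by blast
    then show ?thesis
      using S by blast
  qed
  moreover have "\<Union>K \<subseteq> complex_points V E"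
    using K unfolding one_complex_open_def by blast
  ultimately show "one_complex_open V E (\<Union>K)"
    unfolding one_complex_open_def by blast
qed

lemma openin_one_complex: "openin (one_complex V E) U \<longleftrightarrow> one_complex_open V E U"
  by (simp add: one_complex_def istopology_one_complex_open topology_inverse')

lemma nbhd_basis_subset:
  assumes "p \<in> complex_points V E" "B \<in> nbhd_basis E p"
  shows "B \<subseteq> complex_points V E"
proof (cases p)
  case (Vertex v)
  then have "v \<in> V"
    using assms(1) by (auto simp: complex_points_def inner_points_def)
  then have "half_open_segment v e s \<subseteq> complex_points V E" if "e \<in> incident_edges E v" for e s
    using that unfolding half_open_segment_def complex_points_def inner_points_def incident_edges_def
    by blast
  moreover have "Vertex v \<in> complex_points V E"
    using \<open>v \<in> V\<close> by (simp add: complex_points_def)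
  moreover obtain i where
    "B = insert (Vertex v) (\<Union>e\<in>incident_edges E v. half_open_segment v e (i e))"
    using assms(2) unfolding Vertex nbhd_basis.simps by blast
  ultimately show ?thesis
    by blast
next
  case (Inner e t)
  then show ?thesis
    using assms by (fastforce simp: complex_points_def inner_points_def)
qed

lemma topspace_one_complex [simp]: "topspace (one_complex V E) = complex_points V E"
proof -
  have "one_complex_open V E (complex_points V E)"
    unfolding one_complex_open_def
  proof (intro conjI ballI subset_refl)
    fix p assume p: "p \<in> complex_points V E"
    have "\<exists>B. B \<in> nbhd_basis E p"
    proof (cases p)
      case (Vertex v)
      have "\<forall>e\<in>incident_edges E v. (1/2::real) \<in> {0<..<1}" by simp
      then show ?thesis unfolding Vertex nbhd_basis.simps mem_Collect_eq
        by (intro exI conjI) (rule refl)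
    next
      case (Inner e t)
      then have "0 < t" "t < 1"
        using p by (auto simp: complex_points_def inner_points_def)
      then have "Inner e ` {0<..<1} \<in> nbhd_basis E p"
        unfolding Inner nbhd_basis.simps mem_Collect_eq
        by (intro exI[of _ "0::real"] exI[of _ "1::real"]) simp
      then show ?thesis by blast
    qed
    then show "\<exists>B\<in>nbhd_basis E p. B \<subseteq> complex_points V E"
      using nbhd_basis_subset[OF p] by blast
  qed
  then have "complex_points V E \<subseteq> topspace (one_complex V E)"
    by (intro openin_subset) (simp add: openin_one_complex)
  moreover have "one_complex_open V E (topspace (one_complex V E))"
    using openin_topspace openin_one_complex by blast
  then have "topspace (one_complex V E) \<subseteq> complex_points V E"
    unfolding one_complex_open_def by blast
  ultimately show ?thesis by blast
qed

lemma nbhd_basis_openin: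
  assumes p: "p \<in> complex_points V E" and B: "B \<in> nbhd_basis E p"
  shows "openin (one_complex V E) B \<and> p \<in> B"
proof (cases p)
  case (Vertex v)
  obtain i where i: "\<forall>e\<in>incident_edges E v. i e \<in> {0<..<1::real}"
      "B = insert (Vertex v) (\<Union>e\<in>incident_edges E v. half_open_segment v e (i e))"
    using B unfolding Vertex nbhd_basis.simps by blast
  have "\<exists>C\<in>nbhd_basis E q. C \<subseteq> B" if q: "q \<in> B" for q
  proof (cases "q = p")
    case True
    then show ?thesis using B by blast
  next
    case False
    then obtain e where e: "e \<in> incident_edges E v" and q': "q \<in> half_open_segment v e (i e)"
      using q Vertex unfolding i(2) by blast
    obtain t where qe: "q = Inner e t" and t: "0 < t" "t < 1" "dist_from_end v e t < i e"
      using q' False Vertex unfolding half_open_segment_def by auto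
    have ie: "0 < i e" "i e < 1"
      using i(1) e by auto
    define a where "a = (if v = base_end e then 0 else 1 - i e)"
    define b where "b = (if v = base_end e then i e else 1)"
    have ab: "0 \<le> a \<and> a < t \<and> t < b \<and> b \<le> 1"
      using t ie by (cases "v = base_end e") (simp_all add: a_def b_def dist_from_end_def)
    then have "Inner e ` {a<..<b} \<in> nbhd_basis E q"
      unfolding qe nbhd_basis.simps by blast
    moreover have "s \<in> {0<..<1} \<and> dist_from_end v e s < i e" if "s \<in> {a<..<b}" for s
      using that ie by (cases "v = base_end e") (simp_all add: a_def b_def dist_from_end_def)
    then have "Inner e ` {a<..<b} \<subseteq> half_open_segment v e (i e)"
      unfolding half_open_segment_def by blast
    ultimately show ?thesis
      using e unfolding i(2) by blast
  qed
  then have "openin (one_complex V E) B"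
    using nbhd_basis_subset[OF p B] by (simp add: openin_one_complex one_complex_open_def)
  then show ?thesis
    unfolding Vertex i(2) by simp
next
  case (Inner e t)
  obtain a b where ab: "0 \<le> a" "a < t" "t < b" "b \<le> 1" "B = Inner e ` {a<..<b}"
    using B Inner by auto
  have "B \<in> nbhd_basis E q" if q: "q \<in> B" for q
  proof -
    obtain s where "q = Inner e s" "a < s" "s < b"
      using q unfolding ab(5) by auto
    then show ?thesis
      using ab unfolding ab(5) by auto
  qed
  then have "openin (one_complex V E) B"
    using nbhd_basis_subset[OF p B] by (auto simp: openin_one_complex one_complex_open_def)
  then show ?thesis
    using ab(2,3) unfolding Inner ab(5) by simp
qed


section \<open>Compactifications\<close>

definition totally_disconnected_space :: "'a topology \<Rightarrow> bool" where
  "totally_disconnected_space X \<longleftrightarrow>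
     (\<forall>x\<in>topspace X. connected_component_of_set X x = {x})"

text \<open>
  Containment of \<open>Y\<close> in \<open>X\<close> as a subspace is expressed by an embedding \<open>h\<close>. Compactness does not
  include the Hausdorff property.
\<close>

definition compactification ::
    "'a topology \<Rightarrow> 'b topology \<Rightarrow> ('a \<Rightarrow> 'b) \<Rightarrow> bool" where
  "compactification Y X h \<longleftrightarrow>
     compact_space X \<and> embedding_map Y X h \<and> X closure_of (h ` topspace Y) = topspace X"

definition remainder ::
    "'a topology \<Rightarrow> 'b topology \<Rightarrow> ('a \<Rightarrow> 'b) \<Rightarrow> 'b topology" where
  "remainder Y X h = subtopology X (topspace X - h ` topspace Y)"

end

theory Submission
  imports Defs
begin

text \<open>
  Let \<open>v\<close> be a vertex of infinite degree and \<open>X\<close> a compact Hausdorff space containing the complex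
  with totally disconnected remainder. Cutting off both ends of every edge at \<open>v\<close> leaves a locally
  finite family of arcs \<open>K\<^sub>e\<close> in the complex, no matter how short the ends are and how they vary
  with \<open>e\<close>. So these arcs can accumulate in \<open>X\<close> only at points of the remainder. Limits of
  connected sets in a compact Hausdorff space are connected, and connected subsets of the remainder
  are points; hence some point of the remainder has both endpoints of infinitely many \<open>K\<^sub>e\<close> in
  each of its neighbourhoods (\<open>locally_finite_connected_sets_shrink\<close>).

  This is incompatible with the freedom in the choice of the ends. The midpoints of the edges at
  \<open>v\<close> have a cluster point \<open>x\<close> in the remainder, and \<open>x\<close> and \<open>v\<close> have neighbourhoods with disjoint
  closures. On each of the infinitely many edges whose midpoint is close to \<open>x\<close>, an arc can be
  chosen that runs from that midpoint to a point close to \<open>v\<close>. Those arcs do not shrink to a point.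
\<close>

section \<open>Locally finite families of connected sets in compact Hausdorff spaces\<close>

lemma compact_space_infinite_family_cluster_point:
  assumes X: "compact_space X" and I: "infinite I" and f: "\<And>i. i \<in> I \<Longrightarrow> f i \<in> topspace X"
  shows "\<exists>z\<in>topspace X. \<forall>U. openin X U \<and> z \<in> U \<longrightarrow> infinite {i \<in> I. f i \<in> U}"
proof (rule ccontr)
  assume "\<not> ?thesis"
  then have no: "\<forall>z\<in>topspace X. \<exists>U. openin X U \<and> z \<in> U \<and> finite {i \<in> I. f i \<in> U}"
    by auto
  define \<U> where "\<U> = {U. openin X U \<and> finite {i \<in> I. f i \<in> U}}"
  have "topspace X \<subseteq> \<Union>\<U>"
  proof
    fix z assume "z \<in> topspace X"
    then obtain U where "openin X U" "z \<in> U" "finite {i \<in> I. f i \<in> U}"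
      using no by meson
    then show "z \<in> \<Union>\<U>"
      by (auto simp: \<U>_def)
  qed
  moreover have "\<forall>U\<in>\<U>. openin X U"
    by (simp add: \<U>_def)
  ultimately obtain \<F> where \<F>: "finite \<F>" "\<F> \<subseteq> \<U>" "topspace X \<subseteq> \<Union>\<F>"
    using X unfolding compact_space_alt by metis
  have "finite (\<Union>U\<in>\<F>. {i \<in> I. f i \<in> U})"
    using \<F>(1,2) by (intro finite_UN_I) (auto simp: \<U>_def)
  moreover have "I \<subseteq> (\<Union>U\<in>\<F>. {i \<in> I. f i \<in> U})"
    using f \<F>(3) by blast
  ultimately show False
    using I finite_subset by blast
qed

text \<open>
  In a compact Hausdorff space the components are the quasi-components, so points of a totally
  disconnected closed set \<open>L\<close> can be separated by a partition of \<open>L\<close> into closed sets, which by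
  normality have disjoint open neighbourhoods in the whole space.
\<close>

lemma totally_disconnected_closed_subset_separation:
  assumes X: "compact_space X" "Hausdorff_space X"
    and R: "totally_disconnected_space (subtopology X R)"
    and L: "closedin X L" "L \<subseteq> R"
    and xy: "x \<in> L" "y \<in> L" "x \<noteq> y"
  obtains P Q where "openin X P" "openin X Q" "disjnt P Q" "L \<subseteq> P \<union> Q" "x \<in> P" "y \<in> Q"
proof -
  let ?Y = "subtopology X L"
  have LX: "L \<subseteq> topspace X"
    using L(1) closedin_subset by blast
  have "compact_space ?Y"
    using X(1) L(1) by (simp add: closedin_compact_space compact_space_subtopology)
  moreover have "Hausdorff_space ?Y"
    using X(2) by (rule Hausdorff_space_subtopology)
  ultimately have "quasi_components_of ?Y = connected_components_of ?Y"
    by (intro quasi_eq_connected_components_of) simp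
  then have "quasi_component_of ?Y x = connected_component_of ?Y x"
    using xy(1) LX connected_subset_quasi_components_of_pointwise[of ?Y] by auto
  moreover have "\<not> connected_component_of ?Y x y"
  proof
    assume "connected_component_of ?Y x y"
    then have "connected_component_of (subtopology X R) x y"
      using L(2) by (auto simp: connected_component_of_def connectedin_subtopology)
    moreover have "x \<in> topspace (subtopology X R)"
      using xy(1) L(2) LX by auto
    ultimately have "y \<in> {x}"
      using R unfolding totally_disconnected_space_def by (metis mem_Collect_eq)
    then show False
      using xy(3) by simp
  qed
  ultimately have "\<not> quasi_component_of ?Y x y"
    by simp
  moreover have "x \<in> topspace ?Y" "y \<in> topspace ?Y"
    using xy LX by auto
  ultimately obtain C where C: "closedin ?Y C" "openin ?Y C" "x \<in> C" "y \<notin> C"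
    unfolding quasi_component_of by blast
  have "closedin ?Y (L - C)"
    using C(2) LX by (metis closedin_diff closedin_topspace openin_closedin_eq topspace_subtopology_subset)
  then have "closedin X C" "closedin X (L - C)"
    using C(1) L(1) closedin_trans_full by blast+
  moreover have "normal_space X"
    using X compact_Hausdorff_or_regular_imp_normal_space by blast
  moreover have "disjnt C (L - C)"
    by (simp add: disjnt_def)
  ultimately obtain P Q where PQ: "openin X P" "openin X Q" "C \<subseteq> P" "L - C \<subseteq> Q" "disjnt P Q"
    unfolding normal_space_def by meson
  show thesis
    by (rule that[of P Q]) (use PQ C xy in auto)
qed

text \<open>
  The limit set \<open>L\<close> of the family lies in the totally disconnected set \<open>topspace X - S\<close>. If the
  pairs \<open>(p i, q i)\<close> had a cluster point \<open>(x, y)\<close> with \<open>x \<noteq> y\<close>, then a separation of \<open>x\<close> from \<open>y\<close>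
  in \<open>L\<close> would, by compactness, extend to a separation of all but finitely many of the connected
  sets \<open>K i\<close>, although infinitely many of them meet both sides.
\<close>

lemma locally_finite_connected_sets_shrink:
  assumes X: "compact_space X" "Hausdorff_space X"
    and R: "totally_disconnected_space (subtopology X (topspace X - S))"
    and I: "infinite I"
    and K: "\<And>i. i \<in> I \<Longrightarrow> connectedin X (K i)"
    and pq: "\<And>i. i \<in> I \<Longrightarrow> p i \<in> K i" "\<And>i. i \<in> I \<Longrightarrow> q i \<in> K i"
    and locfin: "\<And>s. s \<in> S \<Longrightarrow> \<exists>U. openin X U \<and> s \<in> U \<and> finite {i \<in> I. K i \<inter> U \<noteq> {}}"
  shows "\<exists>z\<in>topspace X - S. \<forall>U. openin X U \<and> z \<in> U \<longrightarrow> infinite {i \<in> I. p i \<in> U \<and> q i \<in> U}"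
proof -
  have KX: "K i \<subseteq> topspace X" if "i \<in> I" for i
    using K[OF that] by (rule connectedin_subset_topspace)
  define L where
    "L = {x \<in> topspace X. \<forall>U. openin X U \<and> x \<in> U \<longrightarrow> infinite {i \<in> I. K i \<inter> U \<noteq> {}}}"
  have LR: "L \<subseteq> topspace X - S"
    using locfin unfolding L_def by blast
  have "\<exists>U. openin X U \<and> x \<in> U \<and> U \<subseteq> topspace X - L" if x: "x \<in> topspace X - L" for x
  proof -
    obtain U where U: "openin X U" "x \<in> U" "finite {i \<in> I. K i \<inter> U \<noteq> {}}"
      using x by (auto simp: L_def)
    have "U \<subseteq> topspace X - L"
      using U openin_subset[OF U(1)] unfolding L_def by auto
    then show ?thesis
      using U by blast
  qed
  then have "openin X (topspace X - L)"
    by (subst openin_subopen) blast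
  then have clL: "closedin X L"
    using LR unfolding closedin_def by blast
  have in_L: "z \<in> L" if "z \<in> topspace X" "J \<subseteq> I" "\<And>i. i \<in> J \<Longrightarrow> f i \<in> K i"
      "\<And>U. openin X U \<Longrightarrow> z \<in> U \<Longrightarrow> infinite {i \<in> J. f i \<in> U}" for z f J
  proof -
    have "{i \<in> J. f i \<in> U} \<subseteq> {i \<in> I. K i \<inter> U \<noteq> {}}" for U
      using that(2,3) by blast
    then show ?thesis
      unfolding L_def using that(1,4) by (auto dest: infinite_super)
  qed
  have "compact_space (prod_topology X X)"
    using X(1) by (simp add: compact_space_prod_topology)
  moreover have "(p i, q i) \<in> topspace (prod_topology X X)" if "i \<in> I" for i
    using KX pq that by auto
  ultimately have "\<exists>w\<in>topspace (prod_topology X X). \<forall>U. openin (prod_topology X X) U \<and> w \<in> U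
      \<longrightarrow> infinite {i \<in> I. (p i, q i) \<in> U}"
    by (intro compact_space_infinite_family_cluster_point[OF _ I])
  then obtain w where w: "w \<in> topspace (prod_topology X X)"
      "\<And>U. openin (prod_topology X X) U \<Longrightarrow> w \<in> U \<Longrightarrow> infinite {i \<in> I. (p i, q i) \<in> U}"
    by blast
  obtain x y where xy: "w = (x, y)" "x \<in> topspace X" "y \<in> topspace X"
    using w(1) by auto
  have cluster: "infinite {i \<in> I. p i \<in> U \<and> q i \<in> W}"
    if "openin X U" "openin X W" "x \<in> U" "y \<in> W" for U W
    using w(2)[of "U \<times> W"] that xy(1) by (simp add: openin_prod_Times_iff)
  have "infinite {i \<in> I. p i \<in> U}" if "openin X U" "x \<in> U" for U
    using cluster[of U "topspace X"] that xy(3)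
    by (rule_tac infinite_super[rotated]) auto
  then have xL: "x \<in> L"
    using in_L[of x I p] xy pq by blast
  have "infinite {i \<in> I. q i \<in> U}" if "openin X U" "y \<in> U" for U
    using cluster[of "topspace X" U] that xy(2)
    by (rule_tac infinite_super[rotated]) auto
  then have yL: "y \<in> L"
    using in_L[of y I q] xy pq by blast
  have "x = y"
  proof (rule ccontr)
    assume "x \<noteq> y"
    then obtain P Q where PQ: "openin X P" "openin X Q" "disjnt P Q" "L \<subseteq> P \<union> Q" "x \<in> P" "y \<in> Q"
      using totally_disconnected_closed_subset_separation[OF X R clL LR xL yL] by blast
    define J where "J = {i \<in> I. \<not> K i \<subseteq> P \<union> Q}"
    \<comment> \<open>Points of infinitely many \<open>K i\<close> outside \<open>P \<union> Q\<close> would cluster outside \<open>L\<close>.\<close>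
    have "finite J"
    proof (rule ccontr)
      assume "infinite J"
      have "\<forall>i\<in>J. \<exists>a. a \<in> K i - (P \<union> Q)"
        unfolding J_def by blast
      then obtain f where f: "\<And>i. i \<in> J \<Longrightarrow> f i \<in> K i - (P \<union> Q)"
        by metis
      have "f i \<in> topspace X" if "i \<in> J" for i
        using f[OF that] that KX unfolding J_def by blast
      then have "\<exists>z\<in>topspace X. \<forall>U. openin X U \<and> z \<in> U \<longrightarrow> infinite {i \<in> J. f i \<in> U}"
        by (intro compact_space_infinite_family_cluster_point[OF X(1) \<open>infinite J\<close>])
      then obtain z where z: "z \<in> topspace X"
          "\<And>U. openin X U \<Longrightarrow> z \<in> U \<Longrightarrow> infinite {i \<in> J. f i \<in> U}"
        by blast
      have "z \<in> L"
        using in_L[of z J f] z f unfolding J_def by blast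
      then have "z \<in> P \<union> Q" "openin X (P \<union> Q)"
        using PQ by auto
      moreover have "{i \<in> J. f i \<in> P \<union> Q} = {}"
        using f by blast
      ultimately show False
        using z(2)[of "P \<union> Q"] by (metis finite.emptyI)
    qed
    moreover have "{i \<in> I. p i \<in> P \<and> q i \<in> Q} \<subseteq> J"
    proof (rule subsetI, rule ccontr)
      fix i assume i: "i \<in> {i \<in> I. p i \<in> P \<and> q i \<in> Q}" "i \<notin> J"
      then have "K i \<subseteq> P \<union> Q" "P \<inter> K i \<noteq> {}" "Q \<inter> K i \<noteq> {}"
        using pq unfolding J_def by blast+
      moreover have "P \<inter> Q \<inter> K i = {}"
        using PQ(3) by (auto simp: disjnt_def)
      ultimately show False
        using connectedinD[OF K PQ(1,2)] i by blast
    qed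
    ultimately show False
      using cluster[of P Q] PQ finite_subset by blast
  qed
  then show ?thesis
    using xL LR cluster by blast
qed

section \<open>Truncated edges of the 1-complex\<close>

text \<open>
  For every \<open>c\<close>, a vertex has a basic neighbourhood that takes less than \<open>c e\<close> of each incident edge
  \<open>e\<close>; since no uniform lower bound on \<open>c\<close> is required, the truncated edges are locally finite even
  at a vertex of infinite degree. Truncation at both ends makes the statement independent of the
  orientation of the edges.
\<close>

lemma truncated_edges_locally_finite:
  assumes c: "\<And>e. e \<in> E \<Longrightarrow> 0 < c e" "\<And>e. e \<in> E \<Longrightarrow> c e < 1"
    and p: "p \<in> complex_points V E"
  shows "\<exists>B. openin (one_complex V E) B \<and> p \<in> B \<and>
           finite {e \<in> E. Inner e ` {c e..1 - c e} \<inter> B \<noteq> {}}"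
proof (cases p)
  case (Vertex w)
  let ?B = "insert (Vertex w) (\<Union>e\<in>incident_edges E w. half_open_segment w e (c e))"
  have "\<forall>e\<in>incident_edges E w. c e \<in> {0<..<1}"
    using c by (auto simp: incident_edges_def)
  then have "?B \<in> nbhd_basis E p"
    unfolding Vertex nbhd_basis.simps mem_Collect_eq by (intro exI[of _ c] conjI) (rule refl)
  then have "openin (one_complex V E) ?B" "p \<in> ?B"
    using nbhd_basis_openin[OF p] by blast+
  moreover have "Inner e ` {c e..1 - c e} \<inter> ?B = {}" for e
    by (auto simp: half_open_segment_def dist_from_end_def)
  ultimately show ?thesis
    by (metis (mono_tags, lifting) empty_Collect_eq finite.emptyI)
next
  case (Inner e t)
  then have "0 < t" "t < 1"
    using p by (auto simp: complex_points_def inner_points_def)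
  then have "Inner e ` {0<..<1} \<in> nbhd_basis E p"
    unfolding Inner nbhd_basis.simps mem_Collect_eq
    by (intro exI[of _ "0::real"] exI[of _ "1::real"]) simp
  then have "openin (one_complex V E) (Inner e ` {0<..<1})" "p \<in> Inner e ` {0<..<1}"
    using nbhd_basis_openin[OF p] by blast+
  moreover have "{f \<in> E. Inner f ` {c f..1 - c f} \<inter> Inner e ` {0<..<1} \<noteq> {}} \<subseteq> {e}"
    by auto
  ultimately show ?thesis
    by (meson finite.emptyI finite.insertI finite_subset)
qed

lemma continuous_map_Inner:
  assumes "e \<in> E"
  shows "continuous_map (top_of_set {0<..<1}) (one_complex V E) (Inner e)"
  unfolding continuous_map
proof (intro conjI allI impI)
  show "Inner e ` topspace (top_of_set {0<..<1}) \<subseteq> topspace (one_complex V E)"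
    using assms by (auto simp: complex_points_def inner_points_def)
next
  fix U assume U: "openin (one_complex V E) U"
  have "\<exists>T. open T \<and> t \<in> T \<and> T \<subseteq> {t \<in> {0<..<1}. Inner e t \<in> U}"
    if t: "t \<in> {0<..<1}" "Inner e t \<in> U" for t
  proof -
    obtain B where "B \<in> nbhd_basis E (Inner e t)" "B \<subseteq> U"
      using U t(2) unfolding openin_one_complex one_complex_open_def by blast
    then obtain a b where ab: "0 \<le> a" "a < t" "t < b" "b \<le> 1" "Inner e ` {a<..<b} \<subseteq> U"
      by auto
    then have "{a<..<b} \<subseteq> {t \<in> {0<..<1}. Inner e t \<in> U}"
      by auto
    then show ?thesis
      using ab(2,3) by (intro exI[of _ "{a<..<b}"]) auto
  qed
  then have "open {t \<in> {0<..<1}. Inner e t \<in> U}"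
    by (subst open_subopen) blast
  then show "openin (top_of_set {0<..<1}) {t \<in> topspace (top_of_set {0<..<1}). Inner e t \<in> U}"
    by (auto intro: open_subset)
qed

lemma connectedin_truncated_edge:
  assumes "e \<in> E" "0 < c"
  shows "connectedin (one_complex V E) (Inner e ` {c..1 - c})"
proof (rule connectedin_continuous_map_image[OF continuous_map_Inner[OF assms(1)]])
  show "connectedin (top_of_set {0<..<1}) {c..1 - c}"
    using assms(2) by (auto simp: connectedin_subtopology)
qed

lemma embedding_map_openin_extends:
  assumes "embedding_map Y X h" "openin Y B"
  obtains W where "openin X W" "\<And>p. p \<in> topspace Y \<Longrightarrow> h p \<in> W \<longleftrightarrow> p \<in> B"
proof -
  have h: "homeomorphic_map Y (subtopology X (h ` topspace Y)) h"
    using assms(1) by (simp add: embedding_map_def)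
  then have "openin (subtopology X (h ` topspace Y)) (h ` B)"
    using assms(2) by (metis homeomorphic_imp_open_map open_map_def)
  then obtain W where W: "openin X W" "h ` B = W \<inter> h ` topspace Y"
    by (auto simp: openin_subtopology)
  have "inj_on h (topspace Y)"
    using h homeomorphic_imp_injective_map by blast
  moreover have "B \<subseteq> topspace Y"
    using assms(2) by (rule openin_subset)
  ultimately have "h p \<in> W \<longleftrightarrow> p \<in> B" if "p \<in> topspace Y" for p
    using W(2) that by (metis IntD1 IntI image_eqI inj_on_image_mem_iff)
  then show thesis
    using W(1) that by blast
qed

section \<open>Compactifications of complexes with a vertex of infinite degree\<close>

text \<open>
  The points \<open>p e\<close> and \<open>q e\<close> may approach the ends of \<open>e\<close> arbitrarily fast as \<open>e\<close> varies, and
  still they have a common cluster point.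
\<close>

lemma compactified_edges_shrink:
  assumes X: "compact_space X" "Hausdorff_space X"
    and h: "embedding_map (one_complex V E) X h"
    and R: "totally_disconnected_space (remainder (one_complex V E) X h)"
    and I: "infinite I" "I \<subseteq> E"
    and c: "\<And>e. e \<in> I \<Longrightarrow> 0 < c e" "\<And>e. e \<in> I \<Longrightarrow> c e < 1"
    and pq: "\<And>e. e \<in> I \<Longrightarrow> p e \<in> {c e..1 - c e}" "\<And>e. e \<in> I \<Longrightarrow> q e \<in> {c e..1 - c e}"
  shows "\<exists>z\<in>topspace X - h ` complex_points V E. \<forall>U. openin X U \<and> z \<in> U \<longrightarrow>
           infinite {e \<in> I. h (Inner e (p e)) \<in> U \<and> h (Inner e (q e)) \<in> U}"
proof -
  let ?G = "one_complex V E"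
  let ?K = "\<lambda>e. h ` Inner e ` {c e..1 - c e}"
  have hcont: "continuous_map ?G X h"
    using h by (metis embedding_map_def continuous_map_in_subtopology homeomorphic_imp_continuous_map)
  have locfin: "\<exists>U. openin X U \<and> s \<in> U \<and> finite {e \<in> I. ?K e \<inter> U \<noteq> {}}"
    if s: "s \<in> h ` complex_points V E" for s
  proof -
    obtain g where g: "g \<in> complex_points V E" "s = h g"
      using s by blast
    \<comment> \<open>A neighbourhood of a vertex cuts off an end of every incident edge, including those
      outside \<open>I\<close>, for which \<open>c\<close> need not be a valid length.\<close>
    define c' where "c' e = (if e \<in> I then c e else 1/2)" for e
    obtain B where B: "openin ?G B" "g \<in> B"
        "finite {e \<in> E. Inner e ` {c' e..1 - c' e} \<inter> B \<noteq> {}}"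
      using truncated_edges_locally_finite[of E c' g V] c g(1) unfolding c'_def by force
    obtain W where W: "openin X W" "\<And>r. r \<in> complex_points V E \<Longrightarrow> h r \<in> W \<longleftrightarrow> r \<in> B"
      using embedding_map_openin_extends[OF h B(1)] by auto
    have "{e \<in> I. ?K e \<inter> W \<noteq> {}} \<subseteq> {e \<in> E. Inner e ` {c' e..1 - c' e} \<inter> B \<noteq> {}}"
    proof
      fix e assume "e \<in> {e \<in> I. ?K e \<inter> W \<noteq> {}}"
      then obtain t where e: "e \<in> I" and t: "t \<in> {c e..1 - c e}" "h (Inner e t) \<in> W"
        by blast
      have "e \<in> E" "t \<in> {0<..<1}"
        using e t(1) c(1)[OF e] I(2) by auto
      then have "Inner e t \<in> complex_points V E"
        unfolding complex_points_def inner_points_def by blast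
      then have "Inner e t \<in> B"
        using t(2) W(2) by blast
      moreover have "Inner e t \<in> Inner e ` {c' e..1 - c' e}"
        using t(1) e by (simp add: c'_def)
      ultimately show "e \<in> {e \<in> E. Inner e ` {c' e..1 - c' e} \<inter> B \<noteq> {}}"
        using \<open>e \<in> E\<close> by blast
    qed
    then have "finite {e \<in> I. ?K e \<inter> W \<noteq> {}}"
      using B(3) by (rule finite_subset)
    moreover have "s \<in> W"
      using W(2) g B(2) by simp
    ultimately show ?thesis
      using W(1) by blast
  qed
  have K: "connectedin X (?K e)" if "e \<in> I" for e
    using that I(2) c(1)
    by (intro connectedin_continuous_map_image[OF hcont] connectedin_truncated_edge) auto
  have R': "totally_disconnected_space (subtopology X (topspace X - h ` complex_points V E))"
    using R by (simp add: remainder_def)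
  show ?thesis
  proof (rule locally_finite_connected_sets_shrink[OF X R' I(1) K _ _ locfin])
    show "h (Inner e (p e)) \<in> ?K e" "h (Inner e (q e)) \<in> ?K e" if "e \<in> I" for e
      using pq that by blast+
  qed
qed

theorem theorem7p1:
  fixes V :: "'a set" and E :: "'a set set"
  assumes "simple_graph V E"
    and "graph_connected V E"
    and "infinite V"
    and "\<not> locally_finite_graph V E"
  shows "\<not> (\<exists>(X :: 'b topology) h.
           compactification (one_complex V E) X h \<and>
           Hausdorff_space X \<and>
           totally_disconnected_space (remainder (one_complex V E) X h))"
proof
  assume "\<exists>(X :: 'b topology) h.
           compactification (one_complex V E) X h \<and>
           Hausdorff_space X \<and>
           totally_disconnected_space (remainder (one_complex V E) X h)"
  then obtain X :: "'b topology" and h where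
    X: "compact_space X" "Hausdorff_space X"
    and h: "embedding_map (one_complex V E) X h"
    and R: "totally_disconnected_space (remainder (one_complex V E) X h)"
    unfolding compactification_def by blast
  obtain v where v: "v \<in> V" "infinite (incident_edges E v)"
    using assms(4) unfolding locally_finite_graph_def by blast
  let ?I = "incident_edges E v" and ?v = "h (Vertex v)"
  have IE: "?I \<subseteq> E"
    by (auto simp: incident_edges_def)
  have vG: "Vertex v \<in> complex_points V E"
    using v(1) by (simp add: complex_points_def)
  have "h ` topspace (one_complex V E) \<subseteq> topspace X"
    using h by (metis embedding_map_def homeomorphic_imp_surjective_map inf_le1 topspace_subtopology)
  then have vX: "?v \<in> topspace X"
    using vG by auto
  \<comment> \<open>With \<open>c = 1/2\<close> the arcs degenerate to the midpoints of the edges.\<close>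
  have "\<exists>x\<in>topspace X - h ` complex_points V E. \<forall>U. openin X U \<and> x \<in> U \<longrightarrow>
          infinite {e \<in> ?I. h (Inner e (1/2)) \<in> U \<and> h (Inner e (1/2)) \<in> U}"
    by (rule compactified_edges_shrink[OF X h R v(2) IE, of "\<lambda>e. 1/2"]) simp_all
  then obtain x where x: "x \<in> topspace X - h ` complex_points V E"
    and x_cluster: "\<And>U. openin X U \<Longrightarrow> x \<in> U \<Longrightarrow> infinite {e \<in> ?I. h (Inner e (1/2)) \<in> U}"
    by auto
  have reg: "regular_space X"
    using X by (rule compact_Hausdorff_imp_regular_space)
  have "closedin X {?v}"
    using X(2) vX by (simp add: Hausdorff_imp_t1_space closedin_t1_singleton)
  moreover have "x \<in> topspace X - {?v}"
    using x vG by blast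
  ultimately obtain N where N: "openin X N" "x \<in> N" "disjnt {?v} (X closure_of N)"
    using reg unfolding regular_space by meson
  then have "?v \<in> topspace X - X closure_of N"
    using vX by simp
  then obtain W where W: "openin X W" "?v \<in> W" "disjnt (X closure_of N) (X closure_of W)"
    using reg closedin_closure_of[of X N] unfolding regular_space by meson
  have "continuous_map (one_complex V E) X h"
    using h by (metis embedding_map_def continuous_map_in_subtopology homeomorphic_imp_continuous_map)
  then have "openin (one_complex V E) {r \<in> topspace (one_complex V E). h r \<in> W}"
    using W(1) by (rule openin_continuous_map_preimage)
  moreover have "Vertex v \<in> {r \<in> topspace (one_complex V E). h r \<in> W}"
    using vG W(2) by simp
  ultimately obtain B where B: "B \<in> nbhd_basis E (Vertex v)"
      "B \<subseteq> {r \<in> topspace (one_complex V E). h r \<in> W}"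
    unfolding openin_one_complex one_complex_open_def by meson
  then obtain i where i: "\<And>e. e \<in> ?I \<Longrightarrow> i e \<in> {0<..<1::real}"
      "B = insert (Vertex v) (\<Union>e\<in>?I. half_open_segment v e (i e))"
    unfolding nbhd_basis.simps by blast
  define J where "J = {e \<in> ?I. h (Inner e (1/2)) \<in> N}"
  have J: "infinite J" "J \<subseteq> E" "J \<subseteq> ?I"
    using x_cluster[OF N(1,2)] IE by (auto simp: J_def)
  define c where "c e = i e / 2" for e
  have c: "0 < c e" "c e < 1/2" "c e < i e" if "e \<in> J" for e
    using i(1)[of e] that J(3) by (auto simp: c_def)
  \<comment> \<open>\<open>dist_from_end v e\<close> is an involution, so \<open>p e\<close> is the parameter of the point at distance
    \<open>c e\<close> from \<open>v\<close>.\<close>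
  define p where "p e = dist_from_end v e (c e)" for e
  have p: "p e \<in> {c e..1 - c e}" if "e \<in> J" for e
    using c[OF that] by (simp add: p_def dist_from_end_def)
  have pW: "h (Inner e (p e)) \<in> W" if e: "e \<in> J" for e
  proof -
    have "dist_from_end v e (p e) = c e" "p e \<in> {0<..<1}"
      using c[OF e] by (simp_all add: p_def dist_from_end_def)
    then have "Inner e (p e) \<in> half_open_segment v e (i e)"
      using c[OF e] by (simp add: half_open_segment_def)
    moreover have "e \<in> ?I"
      using e J(3) by (rule rev_subsetD)
    ultimately have "Inner e (p e) \<in> B"
      unfolding i(2) by blast
    then show ?thesis
      using B(2) by (simp add: subset_iff)
  qed
  have "\<exists>z\<in>topspace X - h ` complex_points V E. \<forall>U. openin X U \<and> z \<in> U \<longrightarrow>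
          infinite {e \<in> J. h (Inner e (p e)) \<in> U \<and> h (Inner e (1/2)) \<in> U}"
  proof (rule compactified_edges_shrink[OF X h R J(1,2), of c])
    show "0 < c e" "c e < 1" "p e \<in> {c e..1 - c e}" "1/2 \<in> {c e..1 - c e}" if "e \<in> J" for e
      using c[OF that] p[OF that] by simp_all
  qed
  then obtain z where z: "z \<in> topspace X - h ` complex_points V E"
    and z_cluster: "\<forall>U. openin X U \<and> z \<in> U \<longrightarrow>
          infinite {e \<in> J. h (Inner e (p e)) \<in> U \<and> h (Inner e (1/2)) \<in> U}"
    by (rule bexE)
  have z_closure: "z \<in> X closure_of T"
    if T: "\<And>e. e \<in> J \<Longrightarrow> h (Inner e (p e)) \<in> T \<or> h (Inner e (1/2)) \<in> T" for T
    unfolding in_closure_of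
  proof (intro conjI allI impI)
    fix U assume U: "z \<in> U \<and> openin X U"
    then have "infinite {e \<in> J. h (Inner e (p e)) \<in> U \<and> h (Inner e (1/2)) \<in> U}"
      using z_cluster by simp
    then obtain e where "e \<in> J" "h (Inner e (p e)) \<in> U" "h (Inner e (1/2)) \<in> U"
      using not_finite_existsD by blast
    then show "\<exists>y. y \<in> T \<and> y \<in> U"
      using T by blast
  qed (use z in simp)
  have "z \<in> X closure_of N"
    by (rule z_closure) (simp add: J_def)
  moreover have "z \<in> X closure_of W"
    by (rule z_closure) (simp add: pW)
  ultimately show False
    using W(3) by (simp add: disjnt_iff)
qed

end
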